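(* Let $\kappa\geq 1$ be an integer, let $(\alpha_i,\beta_i)$, $i\in\{1,\dots,\kappa\}$, be open intervals with $0<\alpha_1<\beta_1<\alpha_2<\beta_2<\cdots<\alpha_\kappa<\beta_\kappa<1$, all of the same length $h=\beta_i-\alpha_i>0$, and such that, for every $i\in\{1,\dots,\kappa\}$, $(\alpha_i,\beta_i)$ is the reflection of $(\alpha_{\kappa+1-i},\beta_{\kappa+1-i})$ about $0.5$ (i.e., $\alpha_i=1-\beta_{\kappa+1-i}$ and $\beta_i=1-\alpha_{\kappa+1-i}$). Let $a=a_{\kappa,0}\colon[0,1]\to[0,+\infty)$ be the weight defined by $a(x)=0$ if $x\in\bigcup_{i=1}^\kappa(\alpha_i,\beta_i)$ and $a(x)=1$ if $x\in[0,1]\setminus\bigcup_{i=1}^\kappa(\alpha_i,\beta_i)$. For each $\lambda<\pi^2$, let $u_\lambda$ be a positive solution of the boundary value problem $$-u''=\lambda u+a(x)u^3\ \text{ in }(0,1),\qquad u(0)=u(1)=0.$$ Then $$\lim_{\lambda\downarrow-\infty}u_\lambda(x)=0\quad\text{for almost every }x\in\bigcup_{i=1}^\kappa[\alpha_i,\beta_i].$$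
   Context: The parameter $\lambda$ is real; $\kappa$ and the intervals $(\alpha_i,\beta_i)$ are fixed, independent of $\lambda$. A solution $u$ of the boundary value problem (for a given $\lambda$) is a real-valued function $u\in\mathcal{C}^1([0,1])$ that is piecewise $\mathcal{C}^2$, satisfies the differential equation at every point of $(0,1)$ other than the discontinuity points $\alpha_i,\beta_i$ of the weight $a$, and satisfies $u(0)=u(1)=0$. A solution is called positive if $u\geq 0$ on $[0,1]$ and $u\not\equiv 0$; any such solution satisfies $u(x)>0$ for all $x\in(0,1)$, $u'(0)>0$ and $u'(1)<0$. *)

theory Defs
  imports "HOL-Analysis.Analysis"
begin

text \<open>Derivatives are taken relative to \<open>S\<close>, hence one-sided at the endpoints of a closed interval;
  the values of a function outside \<open>S\<close> play no role.\<close>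

definition C1_on :: "(real \<Rightarrow> real) \<Rightarrow> real set \<Rightarrow> bool" where
  "C1_on u S \<longleftrightarrow>
     (\<exists>u'. (\<forall>x\<in>S. (u has_real_derivative u' x) (at x within S)) \<and> continuous_on S u')"

definition C2_on :: "(real \<Rightarrow> real) \<Rightarrow> real set \<Rightarrow> bool" where
  "C2_on u S \<longleftrightarrow>
     (\<exists>u'. (\<forall>x\<in>S. (u has_real_derivative u' x) (at x within S)) \<and> C1_on u' S)"

definition piecewise_C2_on :: "(real \<Rightarrow> real) \<Rightarrow> real \<Rightarrow> real \<Rightarrow> bool" where
  "piecewise_C2_on u a b \<longleftrightarrow>
     (\<exists>P. finite P \<and>
        (\<forall>s t. a \<le> s \<and> s < t \<and> t \<le> b \<and> {s<..<t} \<inter> P = {} \<longrightarrow> C2_on u {s..t}))"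

definition weight :: "nat \<Rightarrow> (nat \<Rightarrow> real) \<Rightarrow> (nat \<Rightarrow> real) \<Rightarrow> real \<Rightarrow> real" where
  "weight \<kappa> \<alpha> \<beta> x = (if x \<in> (\<Union>i\<in>{1..\<kappa>}. {\<alpha> i<..<\<beta> i}) then 0 else 1)"

definition bvp_solution ::
  "nat \<Rightarrow> (nat \<Rightarrow> real) \<Rightarrow> (nat \<Rightarrow> real) \<Rightarrow> real \<Rightarrow> (real \<Rightarrow> real) \<Rightarrow> bool" where
  "bvp_solution \<kappa> \<alpha> \<beta> l u \<longleftrightarrow>
     piecewise_C2_on u 0 1 \<and>
     (\<exists>u'. (\<forall>x\<in>{0..1}. (u has_real_derivative u' x) (at x within {0..1})) \<and>
           continuous_on {0..1} u' \<and>
           (\<forall>x\<in>{0<..<1} - (\<alpha> ` {1..\<kappa>} \<union> \<beta> ` {1..\<kappa>}).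
              \<exists>u''. (u' has_real_derivative u'') (at x) \<and>
                    - u'' = l * u x + weight \<kappa> \<alpha> \<beta> x * u x ^ 3)) \<and>
     u 0 = 0 \<and> u 1 = 0"

definition positive_bvp_solution ::
  "nat \<Rightarrow> (nat \<Rightarrow> real) \<Rightarrow> (nat \<Rightarrow> real) \<Rightarrow> real \<Rightarrow> (real \<Rightarrow> real) \<Rightarrow> bool" where
  "positive_bvp_solution \<kappa> \<alpha> \<beta> l u \<longleftrightarrow>
     bvp_solution \<kappa> \<alpha> \<beta> l u \<and> (\<forall>x\<in>{0..1}. u x \<ge> 0) \<and> (\<exists>x\<in>{0..1}. u x \<noteq> 0)"

end

theory Submission
  imports Defs "HOL-Real_Asymp.Real_Asymp"
begin

text \<open>
  Write \<open>l = - m\<^sup>2\<close> with \<open>m\<close> large. The solution solves \<open>u'' = m\<^sup>2 u - u\<^sup>3\<close> where the weight is \<open>1\<close>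
  and \<open>u'' = m\<^sup>2 u\<close> where it is \<open>0\<close>. On a linear interval \<open>{a..b}\<close>, comparison with exponentials
  (\<open>linear_solution_decay\<close>) shows that \<open>u\<close> is at most its larger boundary value times
  \<open>exp (- m (x - a)) + exp (- m (b - x))\<close>. So everything rests on boundary values that grow
  subexponentially in \<open>m\<close>; in fact they are at most \<open>2 m\<close>.

  Each end of a linear interval is also an end of a superlinear interval of fixed positive length,
  and a solution that exceeds \<open>2 m\<close> anywhere there, the ends included, cannot stay nonnegative
  (\<open>nonneg_cubic_solution_bound\<close>). Indeed, the conserved energy
  \<open>u'\<^sup>2 - m\<^sup>2 u\<^sup>2 + u\<^sup>4 / 2\<close> is then at least \<open>m\<^sup>4\<close>, and at such energies the point \<open>(m u, u')\<close> rotates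
  clockwise about the origin with angular speed at least \<open>m / 2\<close> (\<open>cubic_energy_rotates\<close>).
  A nonnegative \<open>u\<close> confines that point to a half plane, so it has only the angle \<open>\<pi>\<close> to spend,
  whereas the length of the interval is fixed and \<open>m\<close> tends to infinity. This gives
  \<open>u \<le> 2 m\<close> on the superlinear intervals for all large \<open>m\<close>, hence convergence to \<open>0\<close> at every
  interior point of a linear interval; the finitely many end points form a null set.
\<close>

section \<open>Superlinear intervals: rotation in the phase plane\<close>

lemma cubic_energy_constant:
  fixes u v :: "real \<Rightarrow> real"
  assumes "b < c" and "continuous_on {b..c} u" and "continuous_on {b..c} v"
    and du: "\<And>x. x \<in> {b<..<c} \<Longrightarrow> (u has_real_derivative v x) (at x)"
    and dv: "\<And>x. x \<in> {b<..<c} \<Longrightarrow> (v has_real_derivative (m\<^sup>2 * u x - u x ^ 3)) (at x)"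
    and "x \<in> {b..c}" and "y \<in> {b..c}"
  shows "(v x)\<^sup>2 - m\<^sup>2 * (u x)\<^sup>2 + u x ^ 4 / 2 = (v y)\<^sup>2 - m\<^sup>2 * (u y)\<^sup>2 + u y ^ 4 / 2"
proof -
  let ?G = "\<lambda>x. (v x)\<^sup>2 - m\<^sup>2 * (u x)\<^sup>2 + u x ^ 4 / 2"
  have "continuous_on {b..c} ?G"
    using assms(2,3) by (intro continuous_intros) auto
  moreover have "(?G has_real_derivative 0) (at t)" if "b < t" "t < c" for t
    using that
    by (auto intro!: derivative_eq_intros du dv simp: algebra_simps power2_eq_square power3_eq_cube)
  ultimately have "?G t = ?G b" if "t \<in> {b..c}" for t
    using DERIV_isconst2[of b c ?G t] \<open>b < c\<close> that by auto
  then show ?thesis using assms(6,7) by metis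
qed

text \<open>The left-hand side is the derivative of the angle \<open>arctan (p / (m w))\<close> along
  \<open>w' = p\<close>, \<open>p' = m\<^sup>2 w - w\<^sup>3\<close>. The speed \<open>m / 2\<close> amounts to
  \<open>3 m\<^sup>2 w\<^sup>2 \<le> 2 w\<^sup>4 + p\<^sup>2\<close>; bounding \<open>p\<^sup>2\<close> from below by the energy leaves a quadratic form in
  \<open>m\<^sup>2\<close> and \<open>w\<^sup>2\<close>, nonnegative by completing the square.\<close>

lemma cubic_energy_rotates:
  fixes w p :: real
  assumes "0 < m" and "0 < w" and E: "p\<^sup>2 - m\<^sup>2 * w\<^sup>2 + w ^ 4 / 2 \<ge> m ^ 4"
  shows "m * (w * (m\<^sup>2 * w - w ^ 3) - p\<^sup>2) / (m\<^sup>2 * w\<^sup>2 + p\<^sup>2) \<le> - m / 2"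
proof -
  have "0 \<le> 3 * (w\<^sup>2 - 2/3 * m\<^sup>2)\<^sup>2 / 2" by simp
  also have "\<dots> = 3/2 * w ^ 4 - 2 * (m\<^sup>2 * w\<^sup>2) + 2/3 * m ^ 4"
    by (simp add: power2_eq_square power4_eq_xxxx field_simps)
  finally have "2 * (m\<^sup>2 * w\<^sup>2) \<le> 3/2 * w ^ 4 + m ^ 4"
    using zero_le_power[of m 4] \<open>0 < m\<close> by linarith
  with E have *: "2 * (m\<^sup>2 * w\<^sup>2 - w ^ 4 - p\<^sup>2) \<le> - (m\<^sup>2 * w\<^sup>2 + p\<^sup>2)"
    by (simp add: field_simps)
  have "m * (m\<^sup>2 * w\<^sup>2 - w ^ 4 - p\<^sup>2) \<le> - m / 2 * (m\<^sup>2 * w\<^sup>2 + p\<^sup>2)"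
    using mult_left_mono[OF *, of m] \<open>0 < m\<close> by (simp add: algebra_simps)
  moreover have "w * (m\<^sup>2 * w - w ^ 3) = m\<^sup>2 * w\<^sup>2 - w ^ 4"
    by (simp add: power2_eq_square power3_eq_cube power4_eq_xxxx algebra_simps)
  moreover have "0 < m\<^sup>2 * w\<^sup>2 + p\<^sup>2"
    using assms by (intro add_pos_nonneg) auto
  ultimately show ?thesis
    by (simp only: pos_divide_le_eq)
qed

text \<open>The a priori bound. It holds up to the end points of the interval because a large value at an
  end point still forces a large energy throughout. The energy also forbids interior zeros: at such
  a zero a nonnegative \<open>u\<close> has vanishing derivative.\<close>

lemma nonneg_cubic_solution_bound:
  fixes u v :: "real \<Rightarrow> real"
  assumes "0 < m" and wide: "4 * pi \<le> m * (c - b)"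
    and cu: "continuous_on {b..c} u" and cv: "continuous_on {b..c} v"
    and du: "\<And>x. x \<in> {b<..<c} \<Longrightarrow> (u has_real_derivative v x) (at x)"
    and dv: "\<And>x. x \<in> {b<..<c} \<Longrightarrow> (v has_real_derivative (m\<^sup>2 * u x - u x ^ 3)) (at x)"
    and nonneg: "\<And>x. x \<in> {b..c} \<Longrightarrow> 0 \<le> u x"
    and z: "z \<in> {b..c}"
  shows "u z \<le> 2 * m"
proof (rule ccontr)
  assume "\<not> u z \<le> 2 * m"
  then have big: "(2 * m)\<^sup>2 \<le> (u z)\<^sup>2"
    using \<open>0 < m\<close> by (intro power_mono) auto
  have "b < c"
  proof -
    have "0 < m * (c - b)" using wide pi_gt_zero by linarith
    then show ?thesis using \<open>0 < m\<close> by (simp add: zero_less_mult_iff)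
  qed
  have energy: "m ^ 4 \<le> (v x)\<^sup>2 - m\<^sup>2 * (u x)\<^sup>2 + u x ^ 4 / 2" if "x \<in> {b..c}" for x
  proof -
    have "m ^ 4 \<le> (2 * m)\<^sup>2 * m\<^sup>2"
      using \<open>0 < m\<close> by (simp add: power2_eq_square power4_eq_xxxx)
    also have "\<dots> \<le> (u z)\<^sup>2 * ((u z)\<^sup>2 / 2 - m\<^sup>2)"
      using big by (intro mult_mono) (auto simp: power_mult_distrib)
    also have "\<dots> \<le> (v z)\<^sup>2 - m\<^sup>2 * (u z)\<^sup>2 + u z ^ 4 / 2"
      by (simp add: power2_eq_square power4_eq_xxxx algebra_simps)
    also have "\<dots> = (v x)\<^sup>2 - m\<^sup>2 * (u x)\<^sup>2 + u x ^ 4 / 2"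
      using cubic_energy_constant[OF \<open>b < c\<close> cu cv du dv z that] by simp
    finally show ?thesis .
  qed
  have pos: "0 < u x" if x: "x \<in> {b<..<c}" for x
  proof (rule ccontr)
    assume "\<not> 0 < u x"
    then have u0: "u x = 0" using nonneg[of x] x by auto
    \<comment> \<open>An interior zero of a nonnegative function is a minimum, so its energy vanishes.\<close>
    have "v x = 0"
    proof (rule DERIV_local_min[OF du[OF x]])
      show "0 < min (x - b) (c - x)" using x by auto
      show "\<forall>y. \<bar>x - y\<bar> < min (x - b) (c - x) \<longrightarrow> u x \<le> u y"
        using u0 nonneg by (auto simp: abs_less_iff)
    qed
    then show False using energy[of x] u0 x \<open>0 < m\<close> by (auto simp: not_le)
  qed
  \<comment> \<open>On the positive half plane the polar angle of \<open>(m u, v)\<close> is a single arctangent.\<close>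
  define \<theta> where "\<theta> = (\<lambda>x. arctan (v x / (m * u x)))"
  define \<theta>' where
    "\<theta>' = (\<lambda>x. m * (u x * (m\<^sup>2 * u x - u x ^ 3) - (v x)\<^sup>2) / (m\<^sup>2 * (u x)\<^sup>2 + (v x)\<^sup>2))"
  have d\<theta>: "(\<theta> has_real_derivative \<theta>' x) (at x)" if x: "x \<in> {b<..<c}" for x
  proof -
    have ne: "m * u x \<noteq> 0" and ux: "u x \<noteq> 0" using pos[OF x] \<open>0 < m\<close> by auto
    have D: "1 + (v x / (m * u x))\<^sup>2 = (m\<^sup>2 * (u x)\<^sup>2 + (v x)\<^sup>2) / (m\<^sup>2 * (u x)\<^sup>2)"
      using ux \<open>0 < m\<close> by (simp add: field_simps power2_eq_square)
    have "m\<^sup>2 * (u x)\<^sup>2 + (v x)\<^sup>2 > 0"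
      using ux \<open>0 < m\<close> by (intro add_pos_nonneg) auto
    then have eq: "inverse (1 + (v x / (m * u x))\<^sup>2) *
          (((m\<^sup>2 * u x - u x ^ 3) * (m * u x) - v x * (m * v x)) / (m * u x * (m * u x))) = \<theta>' x"
      unfolding D \<theta>'_def using ux \<open>0 < m\<close>
      by (simp add: divide_simps power2_eq_square) (simp add: algebra_simps)
    have "((\<lambda>x. m * u x) has_real_derivative m * v x) (at x)"
      using du[OF x] by (rule DERIV_cmult)
    from DERIV_chain2[OF DERIV_arctan DERIV_divide[OF dv[OF x] this ne]]
    show ?thesis unfolding \<theta>_def eq by simp
  qed
  have rate: "\<theta>' x \<le> - m / 2" if "x \<in> {b<..<c}" for x
    unfolding \<theta>'_def
    using cubic_energy_rotates[OF \<open>0 < m\<close> pos[OF that] energy[of x]] that by auto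
  \<comment> \<open>\<open>u\<close> may vanish at \<open>b\<close> and \<open>c\<close>, where the angle is not the arctangent; the middle half of the
    interval is still long enough to turn by \<open>\<pi>\<close>.\<close>
  define r where "r = (3 * b + c) / 4"
  define t where "t = (b + 3 * c) / 4"
  have rt: "b < r" "r < t" "t < c" and len: "t - r = (c - b) / 2"
    using \<open>b < c\<close> by (auto simp: r_def t_def field_simps)
  from MVT2[of r t \<theta> \<theta>'] rt d\<theta> obtain y where
    y: "r < y" "y < t" "\<theta> t - \<theta> r = (t - r) * \<theta>' y" by auto
  have "(t - r) * \<theta>' y \<le> (t - r) * (- m / 2)"
    using rt y rate[of y] by (intro mult_left_mono) auto
  also have "\<dots> = - (m * (c - b)) / 4" unfolding len by (simp add: field_simps)
  also have "\<dots> \<le> - pi" using wide by simp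
  finally have "\<theta> t - \<theta> r \<le> - pi" using y by simp
  moreover have "- (pi / 2) < \<theta> t" "\<theta> r < pi / 2"
    unfolding \<theta>_def by (rule arctan_lbound, rule arctan_ubound)
  ultimately show False by linarith
qed

section \<open>Linear intervals: exponential decay\<close>

text \<open>At a positive interior maximum the second derivative would be \<open>k f > 0\<close>, so \<open>f\<close> would increase
  just to the right of it.\<close>

lemma linear_maximum_principle:
  fixes f g :: "real \<Rightarrow> real"
  assumes "a \<le> b" and "0 < k" and cf: "continuous_on {a..b} f"
    and df: "\<And>x. x \<in> {a<..<b} \<Longrightarrow> (f has_real_derivative g x) (at x)"
    and dg: "\<And>x. x \<in> {a<..<b} \<Longrightarrow> (g has_real_derivative k * f x) (at x)"
    and "f a \<le> 0" and "f b \<le> 0" and x: "x \<in> {a..b}"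
  shows "f x \<le> 0"
proof (rule ccontr)
  assume "\<not> f x \<le> 0"
  obtain z where z: "z \<in> {a..b}" and zmax: "\<And>y. y \<in> {a..b} \<Longrightarrow> f y \<le> f z"
    using continuous_attains_sup[OF _ _ cf] \<open>a \<le> b\<close> by auto
  have fz: "0 < f z" using zmax[OF x] \<open>\<not> f x \<le> 0\<close> by simp
  then have z': "z \<in> {a<..<b}" using z assms(6,7) by (cases "z = a"; cases "z = b"; auto)
  have "g z = 0"
  proof (rule DERIV_local_max[OF df[OF z']])
    show "0 < min (z - a) (b - z)" using z' by auto
    show "\<forall>y. \<bar>z - y\<bar> < min (z - a) (b - z) \<longrightarrow> f y \<le> f z"
      using zmax by (auto simp: abs_less_iff)
  qed
  moreover have "0 < k * f z" using fz \<open>0 < k\<close> by simp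
  ultimately obtain d where d: "0 < d" "\<And>h. 0 < h \<Longrightarrow> h < d \<Longrightarrow> 0 < g (z + h)"
    using DERIV_pos_inc_right[OF dg[OF z']] by metis
  define y where "y = z + min d (b - z) / 2"
  have y: "z < y" "y < z + d" "y < b"
    using d z' by (auto simp: y_def min_def field_simps)
  obtain t where t: "z < t" "t < y" "f y - f z = (y - z) * g t"
    using MVT2[of z y f g] y z' df by auto
  have "0 < g t" using d(2)[of "t - z"] t y by simp
  then have "0 < (y - z) * g t" using y by simp
  then show False using zmax[of y] t y z' by auto
qed

text \<open>The bound itself solves the same linear equation and is at least \<open>K\<close> at both ends, so the
  difference obeys the maximum principle.\<close>

lemma linear_solution_decay:
  fixes u v :: "real \<Rightarrow> real"
  assumes "a \<le> b" and "0 < m" and "0 \<le> K" and cu: "continuous_on {a..b} u"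
    and du: "\<And>x. x \<in> {a<..<b} \<Longrightarrow> (u has_real_derivative v x) (at x)"
    and dv: "\<And>x. x \<in> {a<..<b} \<Longrightarrow> (v has_real_derivative m\<^sup>2 * u x) (at x)"
    and "u a \<le> K" and "u b \<le> K" and x: "x \<in> {a..b}"
  shows "u x \<le> K * (exp (- (m * (x - a))) + exp (- (m * (b - x))))"
proof -
  let ?w = "\<lambda>x. K * (exp (- (m * (x - a))) + exp (- (m * (b - x))))"
  let ?w' = "\<lambda>x. m * (K * (exp (- (m * (b - x))) - exp (- (m * (x - a)))))"
  have "u x - ?w x \<le> 0"
  proof (rule linear_maximum_principle[where f = "\<lambda>x. u x - ?w x" and g = "\<lambda>x. v x - ?w' x"
        and k = "m\<^sup>2" and a = a and b = b])
    show "continuous_on {a..b} (\<lambda>x. u x - ?w x)"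
      using cu by (intro continuous_intros)
    show "((\<lambda>x. u x - ?w x) has_real_derivative v y - ?w' y) (at y)" if "y \<in> {a<..<b}" for y
      by (auto intro!: derivative_eq_intros du[OF that] simp: algebra_simps)
    show "((\<lambda>x. v x - ?w' x) has_real_derivative m\<^sup>2 * (u y - ?w y)) (at y)"
      if "y \<in> {a<..<b}" for y
      by (auto intro!: derivative_eq_intros dv[OF that] simp: algebra_simps power2_eq_square)
    have "K \<le> ?w a" "K \<le> ?w b"
      using \<open>0 \<le> K\<close> by (auto simp: algebra_simps)
    then show "u a - ?w a \<le> 0" "u b - ?w b \<le> 0" using assms(7,8) by auto
  qed (use assms in auto)
  then show ?thesis by simp
qed

text \<open>The exponential decay beats the bound, linear in \<open>m = sqrt (- l)\<close>, on the boundary values.\<close>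

lemma scaled_decay_tendsto_0:
  assumes "0 < d"
  shows "((\<lambda>l. sqrt (- l) * exp (- (sqrt (- l) * d))) \<longlongrightarrow> 0) at_bot"
proof -
  have "((\<lambda>m. m * exp (- (m * d))) \<longlongrightarrow> 0) at_top"
    using assms by real_asymp
  moreover have "filterlim (\<lambda>l::real. sqrt (- l)) at_top at_bot"
    by real_asymp
  ultimately show ?thesis by (rule filterlim_compose)
qed

section \<open>Geometry of the weight and the limit\<close>

lemma bvp_solution_derivatives:
  assumes "bvp_solution \<kappa> \<alpha> \<beta> l u"
  shows "\<exists>v. continuous_on {0..1} u \<and> continuous_on {0..1} v \<and>
    (\<forall>x\<in>{0<..<1}. (u has_real_derivative v x) (at x)) \<and>
    (\<forall>x\<in>{0<..<1} - (\<alpha> ` {1..\<kappa>} \<union> \<beta> ` {1..\<kappa>}).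
      (v has_real_derivative (- l * u x - weight \<kappa> \<alpha> \<beta> x * u x ^ 3)) (at x))"
proof -
  from assms obtain v where
    d: "\<And>x. x \<in> {0..1} \<Longrightarrow> (u has_real_derivative v x) (at x within {0..1})"
    and c: "continuous_on {0..1} v"
    and eq: "\<And>x. x \<in> {0<..<1} - (\<alpha> ` {1..\<kappa>} \<union> \<beta> ` {1..\<kappa>}) \<Longrightarrow>
              \<exists>u''. (v has_real_derivative u'') (at x) \<and>
                    - u'' = l * u x + weight \<kappa> \<alpha> \<beta> x * u x ^ 3"
    unfolding bvp_solution_def by blast
  have "(v has_real_derivative (- l * u x - weight \<kappa> \<alpha> \<beta> x * u x ^ 3)) (at x)"
    if x: "x \<in> {0<..<1} - (\<alpha> ` {1..\<kappa>} \<union> \<beta> ` {1..\<kappa>})" for x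
  proof -
    obtain D where D: "(v has_real_derivative D) (at x)"
      and "- D = l * u x + weight \<kappa> \<alpha> \<beta> x * u x ^ 3"
      using eq[OF x] by blast
    then have "D = - l * u x - weight \<kappa> \<alpha> \<beta> x * u x ^ 3" by linarith
    with D show ?thesis by simp
  qed
  moreover have "(u has_real_derivative v x) (at x)" if "x \<in> {0<..<1}" for x
    using d[of x] that by (simp add: at_within_Icc_at)
  moreover have "continuous_on {0..1} u" using d by (rule DERIV_continuous_on)
  ultimately show ?thesis using c by blast
qed

lemma positive_solution_bound_outside:
  assumes sol: "positive_bvp_solution \<kappa> \<alpha> \<beta> (- (m\<^sup>2)) u"
    and "0 < m" and "4 * pi \<le> m * (c - b)" and "0 \<le> b" and "c \<le> 1"
    and out: "\<And>x j. x \<in> {b<..<c} \<Longrightarrow> j \<in> {1..\<kappa>} \<Longrightarrow> x \<notin> {\<alpha> j..\<beta> j}"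
    and less: "\<And>j. j \<in> {1..\<kappa>} \<Longrightarrow> \<alpha> j < \<beta> j"
    and "z \<in> {b..c}"
  shows "u z \<le> 2 * m"
proof -
  from sol have "bvp_solution \<kappa> \<alpha> \<beta> (- (m\<^sup>2)) u" and nn: "\<And>x. x \<in> {0..1} \<Longrightarrow> 0 \<le> u x"
    by (auto simp: positive_bvp_solution_def)
  then obtain v where cu: "continuous_on {0..1} u" and cv: "continuous_on {0..1} v"
    and du: "\<forall>x\<in>{0<..<1}. (u has_real_derivative v x) (at x)"
    and dv: "\<forall>x\<in>{0<..<1} - (\<alpha> ` {1..\<kappa>} \<union> \<beta> ` {1..\<kappa>}).
      (v has_real_derivative (- (- (m\<^sup>2)) * u x - weight \<kappa> \<alpha> \<beta> x * u x ^ 3)) (at x)"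
    using bvp_solution_derivatives[of \<kappa> \<alpha> \<beta> "- (m\<^sup>2)" u] by blast
  have sub: "{b..c} \<subseteq> {0..1}" using assms(4,5) by auto
  show ?thesis
  proof (rule nonneg_cubic_solution_bound[where u = u and v = v and z = z, OF assms(2,3)])
    show "continuous_on {b..c} u" "continuous_on {b..c} v"
      using cu cv sub continuous_on_subset by blast+
    show "(u has_real_derivative v x) (at x)" if "x \<in> {b<..<c}" for x
      using du that assms(4,5) by auto
    show "(v has_real_derivative m\<^sup>2 * u x - u x ^ 3) (at x)" if x: "x \<in> {b<..<c}" for x
    proof -
      have "x \<notin> \<alpha> ` {1..\<kappa>} \<union> \<beta> ` {1..\<kappa>}"
      proof
        assume "x \<in> \<alpha> ` {1..\<kappa>} \<union> \<beta> ` {1..\<kappa>}"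
        then obtain j where j: "j \<in> {1..\<kappa>}" "x = \<alpha> j \<or> x = \<beta> j" by blast
        with less[OF j(1)] have "x \<in> {\<alpha> j..\<beta> j}" by auto
        with out[OF x j(1)] show False by blast
      qed
      moreover have "weight \<kappa> \<alpha> \<beta> x = 1"
        unfolding weight_def using out[OF x] by (auto dest!: less_imp_le)
      ultimately show ?thesis using dv[rule_format, of x] x assms(4,5) by simp
    qed
    show "0 \<le> u x" if "x \<in> {b..c}" for x using nn that sub by auto
  qed (rule assms)
qed

lemma ordered_intervals_less:
  fixes \<alpha> \<beta> :: "nat \<Rightarrow> real"
  assumes less: "\<And>i. i \<in> {1..\<kappa>} \<Longrightarrow> \<alpha> i < \<beta> i"
    and gap: "\<And>i. i \<in> {1..<\<kappa>} \<Longrightarrow> \<beta> i < \<alpha> (i + 1)"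
    and "1 \<le> i" and "i < j" and "j \<le> \<kappa>"
  shows "\<beta> i < \<alpha> j"
proof -
  from \<open>i < j\<close> have "Suc i \<le> j" by simp
  then show ?thesis using \<open>j \<le> \<kappa>\<close>
  proof (induction j rule: dec_induct)
    case base
    then show ?case using gap[of i] \<open>1 \<le> i\<close> by simp
  next
    case (step n)
    then show ?case using gap[of n] less[of n] \<open>1 \<le> i\<close> by simp
  qed
qed

text \<open>The gaps to the left and right of an interval are where the weight is \<open>1\<close>. Their closures share
  an end point with the interval, which is how the bound on the gaps controls its boundary values.\<close>

lemma adjacent_gaps:
  fixes \<alpha> \<beta> :: "nat \<Rightarrow> real"
  assumes "0 < \<alpha> 1"
    and less: "\<And>i. i \<in> {1..\<kappa>} \<Longrightarrow> \<alpha> i < \<beta> i"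
    and gap: "\<And>i. i \<in> {1..<\<kappa>} \<Longrightarrow> \<beta> i < \<alpha> (i + 1)"
    and "\<beta> \<kappa> < 1"
    and i: "i \<in> {1..\<kappa>}"
  obtains b c where "0 \<le> b" "b < \<alpha> i" "\<beta> i < c" "c \<le> 1"
    "\<And>x j. x \<in> {b<..<\<alpha> i} \<union> {\<beta> i<..<c} \<Longrightarrow> j \<in> {1..\<kappa>} \<Longrightarrow> x \<notin> {\<alpha> j..\<beta> j}"
proof -
  note ord = ordered_intervals_less[of \<kappa> \<alpha> \<beta>, OF less gap]
  have ord': "\<alpha> i < \<alpha> j" "\<beta> i < \<beta> j" if "1 \<le> i" "i < j" "j \<le> \<kappa>" for i j
    using ord[OF _ _ that] less[of i] less[of j] that by fastforce+
  define b where "b = (if i = 1 then 0 else \<beta> (i - 1))"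
  define c where "c = (if i = \<kappa> then 1 else \<alpha> (i + 1))"
  have \<alpha>0: "0 < \<alpha> j" if "j \<in> {1..\<kappa>}" for j
    using ord'(1)[of 1 j] \<open>0 < \<alpha> 1\<close> that by (cases "j = 1") auto
  have \<beta>1: "\<beta> j < 1" if "j \<in> {1..\<kappa>}" for j
    using ord'(2)[of j \<kappa>] \<open>\<beta> \<kappa> < 1\<close> that by (cases "j = \<kappa>") auto
  have left: "\<beta> j \<le> b" if "1 \<le> j" "j < i" for j
    using that i ord'(2)[of j "i - 1"] by (cases "j = i - 1") (auto simp: b_def intro: less_imp_le)
  have right: "c \<le> \<alpha> j" if "i < j" "j \<le> \<kappa>" for j
    using that i ord'(1)[of "i + 1" j] by (cases "j = i + 1") (auto simp: c_def intro: less_imp_le)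
  show thesis
  proof (rule that[of b c])
    have "0 \<le> \<beta> (i - 1)" if "i \<noteq> 1"
      using \<alpha>0[of "i - 1"] less[of "i - 1"] that i by fastforce
    then show "0 \<le> b" by (simp add: b_def)
    show "b < \<alpha> i" using \<alpha>0[OF i] ord[of "i - 1" i] i by (auto simp: b_def)
    show "\<beta> i < c" using \<beta>1[OF i] ord[of i "i + 1"] i by (auto simp: c_def)
    have "\<alpha> (i + 1) \<le> 1" if "i \<noteq> \<kappa>"
      using \<beta>1[of "i + 1"] less[of "i + 1"] that i by fastforce
    then show "c \<le> 1" by (simp add: c_def)
    show "x \<notin> {\<alpha> j..\<beta> j}" if x: "x \<in> {b<..<\<alpha> i} \<union> {\<beta> i<..<c}" and j: "j \<in> {1..\<kappa>}" for x j
    proof (cases i j rule: linorder_cases)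
      case less
      then show ?thesis using x j right[of j] assms(2)[OF i] ord[of i j] i by auto
    next
      case equal
      then show ?thesis using x by auto
    next
      case greater
      then show ?thesis using x j left[of j] assms(2)[OF i] ord[of j i] i by auto
    qed
  qed
qed

lemma positive_solution_decay_inside:
  assumes sol: "positive_bvp_solution \<kappa> \<alpha> \<beta> (- (m\<^sup>2)) u"
    and "0 < m" and "0 \<le> K" and i: "i \<in> {1..\<kappa>}"
    and ab: "0 < \<alpha> i" "\<alpha> i < \<beta> i" "\<beta> i < 1"
    and disj: "\<And>j x. j \<in> {1..\<kappa>} \<Longrightarrow> x \<in> {\<alpha> i<..<\<beta> i} \<Longrightarrow> x \<noteq> \<alpha> j \<and> x \<noteq> \<beta> j"
    and "u (\<alpha> i) \<le> K" and "u (\<beta> i) \<le> K" and "x \<in> {\<alpha> i..\<beta> i}"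
  shows "u x \<le> K * (exp (- (m * (x - \<alpha> i))) + exp (- (m * (\<beta> i - x))))"
proof -
  from sol have "bvp_solution \<kappa> \<alpha> \<beta> (- (m\<^sup>2)) u"
    by (auto simp: positive_bvp_solution_def)
  then obtain v where cu: "continuous_on {0..1} u"
    and du: "\<forall>x\<in>{0<..<1}. (u has_real_derivative v x) (at x)"
    and dv: "\<forall>x\<in>{0<..<1} - (\<alpha> ` {1..\<kappa>} \<union> \<beta> ` {1..\<kappa>}).
      (v has_real_derivative (- (- (m\<^sup>2)) * u x - weight \<kappa> \<alpha> \<beta> x * u x ^ 3)) (at x)"
    using bvp_solution_derivatives[of \<kappa> \<alpha> \<beta> "- (m\<^sup>2)" u] by blast
  show ?thesis
  proof (rule linear_solution_decay[where u = u and v = v and x = x])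
    show "continuous_on {\<alpha> i..\<beta> i} u"
      using cu by (rule continuous_on_subset) (use ab in auto)
    show "(u has_real_derivative v y) (at y)" if "y \<in> {\<alpha> i<..<\<beta> i}" for y
      using du that ab by auto
    show "(v has_real_derivative m\<^sup>2 * u y) (at y)" if y: "y \<in> {\<alpha> i<..<\<beta> i}" for y
    proof -
      have "y \<notin> \<alpha> ` {1..\<kappa>} \<union> \<beta> ` {1..\<kappa>}" using disj[OF _ y] by blast
      moreover have "weight \<kappa> \<alpha> \<beta> y = 0" unfolding weight_def using i y by auto
      ultimately show ?thesis using dv[rule_format, of y] y ab by simp
    qed
  qed (use assms in auto)
qed

theorem theorem2p1:
  fixes \<kappa> :: nat and \<alpha> \<beta> :: "nat \<Rightarrow> real" and h :: real and u :: "real \<Rightarrow> real \<Rightarrow> real"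
  assumes "\<kappa> \<ge> 1"
    and "0 < \<alpha> 1"
    and "\<And>i. i \<in> {1..\<kappa>} \<Longrightarrow> \<alpha> i < \<beta> i"
    and "\<And>i. i \<in> {1..<\<kappa>} \<Longrightarrow> \<beta> i < \<alpha> (i + 1)"
    and "\<beta> \<kappa> < 1"
    and "h > 0"
    and "\<And>i. i \<in> {1..\<kappa>} \<Longrightarrow> \<beta> i - \<alpha> i = h"
    and "\<And>i. i \<in> {1..\<kappa>} \<Longrightarrow> \<alpha> i = 1 - \<beta> (\<kappa> + 1 - i)"
    and "\<And>i. i \<in> {1..\<kappa>} \<Longrightarrow> \<beta> i = 1 - \<alpha> (\<kappa> + 1 - i)"
    and "\<And>l. l < pi\<^sup>2 \<Longrightarrow> positive_bvp_solution \<kappa> \<alpha> \<beta> l (u l)"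
  shows "AE x in lebesgue. x \<in> (\<Union>i\<in>{1..\<kappa>}. {\<alpha> i..\<beta> i}) \<longrightarrow> ((\<lambda>l. u l x) \<longlongrightarrow> 0) at_bot"
proof -
  have interior: "((\<lambda>l. u l x) \<longlongrightarrow> 0) at_bot"
    if i: "i \<in> {1..\<kappa>}" and x: "x \<in> {\<alpha> i<..<\<beta> i}" for i x
  proof -
    obtain b c where bc: "0 \<le> b" "b < \<alpha> i" "\<beta> i < c" "c \<le> 1"
      and out: "\<And>x j. x \<in> {b<..<\<alpha> i} \<union> {\<beta> i<..<c} \<Longrightarrow> j \<in> {1..\<kappa>} \<Longrightarrow> x \<notin> {\<alpha> j..\<beta> j}"
      using adjacent_gaps[OF assms(2-5) i] by blast
    have disj: "y \<noteq> \<alpha> j \<and> y \<noteq> \<beta> j" if j: "j \<in> {1..\<kappa>}" and y: "y \<in> {\<alpha> i<..<\<beta> i}" for j y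
      using ordered_intervals_less[of \<kappa> \<alpha> \<beta>, OF assms(3,4), of i j]
        ordered_intervals_less[of \<kappa> \<alpha> \<beta>, OF assms(3,4), of j i] assms(3)[OF i] assms(3)[OF j] i j y
      by (cases i j rule: linorder_cases) auto
    \<comment> \<open>With \<open>m = sqrt (- l) \<ge> 4 * pi / d\<close> both adjacent gaps are wide enough for the a priori bound.\<close>
    define d where "d = min (\<alpha> i - b) (c - \<beta> i)"
    have d: "0 < d" using bc by (simp add: d_def)
    let ?m = "\<lambda>l. sqrt (- l)"
    let ?B = "\<lambda>l. 2 * ?m l * (exp (- (?m l * (x - \<alpha> i))) + exp (- (?m l * (\<beta> i - x))))"
    have bound: "0 \<le> u l x \<and> u l x \<le> ?B l" if "l \<le> - (4 * pi / d)\<^sup>2" for l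
    proof -
      have "sqrt ((4 * pi / d)\<^sup>2) \<le> ?m l" using that by (intro real_sqrt_le_mono) simp
      then have md: "4 * pi / d \<le> ?m l" using d by simp
      have "0 < 4 * pi / d" using d by simp
      then have m0: "0 < ?m l" using md by linarith
      then have "l < 0" by simp
      then have l: "- ((?m l)\<^sup>2) = l" by simp
      have "l < pi\<^sup>2" using \<open>l < 0\<close> zero_le_power2[of pi] by linarith
      then have sol: "positive_bvp_solution \<kappa> \<alpha> \<beta> l (u l)" by (rule assms)
      then have sol': "positive_bvp_solution \<kappa> \<alpha> \<beta> (- ((?m l)\<^sup>2)) (u l)" by (simp only: l)
      have "4 * pi \<le> ?m l * d" using md d by (simp add: field_simps)
      moreover have "?m l * d \<le> ?m l * (\<alpha> i - b)" "?m l * d \<le> ?m l * (c - \<beta> i)"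
        using m0 by (intro mult_left_mono; simp add: d_def)+
      ultimately have wide: "4 * pi \<le> ?m l * (\<alpha> i - b)" "4 * pi \<le> ?m l * (c - \<beta> i)"
        by linarith+
      have "u l (\<alpha> i) \<le> 2 * ?m l"
        using bc assms(3)[OF i]
        by (intro positive_solution_bound_outside[OF sol' m0 wide(1) _ _ out assms(3)]) auto
      moreover have "u l (\<beta> i) \<le> 2 * ?m l"
        using bc assms(3)[OF i]
        by (intro positive_solution_bound_outside[OF sol' m0 wide(2) _ _ out assms(3)]) auto
      ultimately have "u l x \<le> ?B l"
        using bc x m0 i disj
        by (intro positive_solution_decay_inside[OF sol']) auto
      moreover have "0 \<le> u l x"
        using sol bc x by (auto simp: positive_bvp_solution_def)
      ultimately show ?thesis by blast
    qed
    have ev: "\<forall>\<^sub>F l in at_bot. 0 \<le> u l x \<and> u l x \<le> ?B l"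
      using eventually_le_at_bot[of "- (4 * pi / d)\<^sup>2"] by eventually_elim (rule bound)
    have p: "0 < x - \<alpha> i" and q: "0 < \<beta> i - x" using x by auto
    have "((\<lambda>l. 2 * (?m l * exp (- (?m l * (x - \<alpha> i))) + ?m l * exp (- (?m l * (\<beta> i - x)))))
        \<longlongrightarrow> 2 * (0 + 0)) at_bot"
      by (intro tendsto_intros scaled_decay_tendsto_0 p q)
    then have "(?B \<longlongrightarrow> 0) at_bot" by (simp add: algebra_simps)
    with ev show ?thesis
      by (intro tendsto_sandwich[of "\<lambda>_. 0" "\<lambda>l. u l x" at_bot ?B 0])
        (auto elim: eventually_mono)
  qed
  have "finite (\<alpha> ` {1..\<kappa>} \<union> \<beta> ` {1..\<kappa>})" by simp
  then have "\<alpha> ` {1..\<kappa>} \<union> \<beta> ` {1..\<kappa>} \<in> null_sets lebesgue"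
    using negligible_finite negligible_iff_null_sets by blast
  moreover have "{x \<in> space lebesgue. \<not> (x \<in> (\<Union>i\<in>{1..\<kappa>}. {\<alpha> i..\<beta> i}) \<longrightarrow> ((\<lambda>l. u l x) \<longlongrightarrow> 0) at_bot)}
      \<subseteq> \<alpha> ` {1..\<kappa>} \<union> \<beta> ` {1..\<kappa>}"
  proof
    fix x
    assume "x \<in> {x \<in> space lebesgue. \<not> (x \<in> (\<Union>i\<in>{1..\<kappa>}. {\<alpha> i..\<beta> i}) \<longrightarrow> ((\<lambda>l. u l x) \<longlongrightarrow> 0) at_bot)}"
    then obtain i where "i \<in> {1..\<kappa>}" "x \<in> {\<alpha> i..\<beta> i}" "\<not> ((\<lambda>l. u l x) \<longlongrightarrow> 0) at_bot"
      by blast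
    with interior[of i x] have "x = \<alpha> i \<or> x = \<beta> i" by force
    with \<open>i \<in> {1..\<kappa>}\<close> show "x \<in> \<alpha> ` {1..\<kappa>} \<union> \<beta> ` {1..\<kappa>}" by blast
  qed
  ultimately show ?thesis by (rule AE_I')
qed

end
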